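(* For all $x\in\left(0,\frac{\pi}{2}\right)$ one has $$\cot x+\coth x<\frac{2}{x},$$ $$\tan x\cdot\tanh x>x^2,$$ $$\tan x+\tanh x>2x,$$ $$\cos x\cdot\cosh x<\frac{\sin x\cdot\sinh x}{x^2}<1.$$ *)

theory Defs
  imports Complex_Main
begin

definition coth :: "real \<Rightarrow> real" where
  "coth x = cosh x / sinh x"

end

theory Submission
  imports Defs
begin

text \<open>Since \<open>tan x > x > tanh x\<close>, the derivative \<open>tan\<^sup>2 x - tanh\<^sup>2 x\<close> of \<open>tan x + tanh x - 2 x\<close> is positive,
  which gives the third inequality. The first follows from it because
  \<open>2 sin x sinh x - x (cos x sinh x + sin x cosh x)\<close> has derivative
  \<open>cos x cosh x (tan x + tanh x - 2 x)\<close>. By AM-GM the first implies \<open>cot x coth x < 1 / x\<^sup>2\<close>,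
  hence the second and the left half of the fourth. Finally \<open>x\<^sup>2 - sin x sinh x\<close> vanishes to
  second order at \<open>0\<close> and has second derivative \<open>2 (1 - cos x cosh x)\<close>, which is positive because
  \<open>cos x cosh x\<close> has derivative \<open>cos x cosh x (tanh x - tan x)\<close>.\<close>

text \<open>A positive derivative on the open interval makes \<open>f\<close> strictly increasing on
  \<open>{0..x}\<close>. The derivative at \<open>0\<close> serves only for continuity there. Its
  sign at \<open>0\<close> is left free because \<open>f' 0 = 0\<close> in every application
  below.\<close>

lemma pos_if_zero_and_deriv_pos:
  fixes f f' :: "real \<Rightarrow> real"
  assumes "f 0 = 0"
    and deriv: "\<And>t. 0 \<le> t \<Longrightarrow> t < b \<Longrightarrow> (f has_real_derivative f' t) (at t)"
    and pos: "\<And>t. 0 < t \<Longrightarrow> t < b \<Longrightarrow> f' t > 0"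
    and x: "0 < x" "x < b"
  shows "f x > 0"
proof -
  have "f 0 < f x"
  proof (rule DERIV_pos_imp_increasing_open[OF x(1)])
    show "\<exists>y. (f has_real_derivative y) (at t) \<and> y > 0" if "0 < t" "t < x" for t
      using deriv[of t] pos[of t] that x by auto
    show "continuous_on {0..x} f"
      by (intro continuous_at_imp_continuous_on ballI DERIV_isCont[OF deriv]) (use x in auto)
  qed
  with assms(1) show ?thesis by simp
qed

lemma cos_pos_pi_half: "0 \<le> t \<Longrightarrow> t < pi / 2 \<Longrightarrow> cos t > 0"
  by (intro cos_gt_zero_pi) auto

lemma sin_pos_pi_half: "0 < t \<Longrightarrow> t < pi / 2 \<Longrightarrow> sin t > 0"
  by (intro sin_gt_zero) auto

lemma tan_greater_self:
  assumes "0 < x" "x < pi / 2"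
  shows "tan x > x"
proof -
  have "tan x - x > 0"
  proof (rule pos_if_zero_and_deriv_pos[where f = "\<lambda>t. tan t - t" and f' = "\<lambda>t. (tan t)\<^sup>2" and b = "pi / 2"])
    show "((\<lambda>t. tan t - t) has_real_derivative (tan t)\<^sup>2) (at t)" if "0 \<le> t" "t < pi / 2" for t
      \<comment> \<open>\<open>cos t > 0\<close> makes \<open>tan\<close> differentiable at
        \<open>t\<close>, and \<open>tan_sec\<close> turns the secant squared in its derivative into
        \<open>1 + (tan t)\<^sup>2\<close>.\<close>
      using cos_pos_pi_half[OF that]
      by (auto intro!: derivative_eq_intros simp: tan_sec[symmetric] power_inverse[symmetric])
    show "(tan t)\<^sup>2 > 0" if "0 < t" "t < pi / 2" for t
      using tan_gt_zero[OF that] by simp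
  qed (use assms in auto)
  then show ?thesis by simp
qed

lemma tanh_less_self:
  fixes x :: real
  assumes "0 < x"
  shows "tanh x < x"
proof -
  have "x - tanh x > 0"
  \<comment> \<open>The bound holds on the whole positive axis, so any \<open>b\<close> beyond
    \<open>x\<close> will do.\<close>
  proof (rule pos_if_zero_and_deriv_pos[where f = "\<lambda>t. t - tanh t" and f' = "\<lambda>t. (tanh t)\<^sup>2" and b = "x + 1"])
    show "((\<lambda>t. t - tanh t) has_real_derivative (tanh t)\<^sup>2) (at t)" for t :: real
      by (auto intro!: derivative_eq_intros)
  qed (use assms in auto)
  then show ?thesis by simp
qed

lemma tan_add_tanh_greater:
  assumes "0 < x" "x < pi / 2"
  shows "tan x + tanh x > 2 * x"
proof -
  have "tan x + tanh x - 2 * x > 0"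
  proof (rule pos_if_zero_and_deriv_pos[where f = "\<lambda>t. tan t + tanh t - 2 * t"
        and f' = "\<lambda>t. (tan t)\<^sup>2 - (tanh t)\<^sup>2" and b = "pi / 2"])
    show "((\<lambda>t. tan t + tanh t - 2 * t) has_real_derivative (tan t)\<^sup>2 - (tanh t)\<^sup>2) (at t)"
      if "0 \<le> t" "t < pi / 2" for t
      using cos_pos_pi_half[OF that]
      by (auto intro!: derivative_eq_intros simp: tan_sec[symmetric] power_inverse[symmetric])
    show "(tan t)\<^sup>2 - (tanh t)\<^sup>2 > 0" if "0 < t" "t < pi / 2" for t
      \<comment> \<open>Squaring keeps the order since
        \<open>0 < tanh t < t < tan t\<close>.\<close>
      using tan_greater_self[OF that] tanh_less_self[OF that(1)] that
      by (simp add: power_strict_mono)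
  qed (use assms in auto)
  then show ?thesis by simp
qed

text \<open>This is \<open>cot x + coth x < 2 / x\<close> multiplied by
  \<open>x * sin x * sinh x > 0\<close>; without denominators both sides are smooth at
  \<open>0\<close>. In the derivative the \<open>sin t * sinh t\<close> terms cancel.\<close>

lemma cos_sinh_add_sin_cosh_less:
  assumes "0 < x" "x < pi / 2"
  shows "x * (cos x * sinh x + sin x * cosh x) < 2 * (sin x * sinh x)"
proof -
  have "2 * (sin x * sinh x) - x * (cos x * sinh x + sin x * cosh x) > 0"
  proof (rule pos_if_zero_and_deriv_pos[where b = "pi / 2"
        and f = "\<lambda>t. 2 * (sin t * sinh t) - t * (cos t * sinh t + sin t * cosh t)"
        and f' = "\<lambda>t. cos t * sinh t + sin t * cosh t - 2 * t * (cos t * cosh t)"])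
    show "((\<lambda>t. 2 * (sin t * sinh t) - t * (cos t * sinh t + sin t * cosh t)) has_real_derivative
      cos t * sinh t + sin t * cosh t - 2 * t * (cos t * cosh t)) (at t)" for t :: real
      by (auto intro!: derivative_eq_intros simp: algebra_simps)
    fix t :: real assume t: "0 < t" "t < pi / 2"
    have "cos t > 0" using t by (intro cos_pos_pi_half) auto
    then have "cos t * sinh t + sin t * cosh t - 2 * t * (cos t * cosh t) =
        cos t * cosh t * (tan t + tanh t - 2 * t)"
      by (simp add: tan_def tanh_def field_simps)
    also have "\<dots> > 0"
      using \<open>cos t > 0\<close> tan_add_tanh_greater[OF t] by simp
    finally show "cos t * sinh t + sin t * cosh t - 2 * t * (cos t * cosh t) > 0" .
  qed (use assms in auto)
  then show ?thesis by simp
qed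

lemma cos_cosh_less_one:
  assumes "0 < x" "x < pi / 2"
  shows "cos x * cosh x < 1"
proof -
  have "1 - cos x * cosh x > 0"
  proof (rule pos_if_zero_and_deriv_pos[where b = "pi / 2" and f = "\<lambda>t. 1 - cos t * cosh t"
        and f' = "\<lambda>t. sin t * cosh t - cos t * sinh t"])
    show "((\<lambda>t. 1 - cos t * cosh t) has_real_derivative sin t * cosh t - cos t * sinh t) (at t)"
      for t :: real
      by (auto intro!: derivative_eq_intros)
    fix t :: real assume t: "0 < t" "t < pi / 2"
    have "cos t > 0" using t by (intro cos_pos_pi_half) auto
    \<comment> \<open>Factoring out the positive \<open>cos t * cosh t\<close> reduces the sign to
      \<open>tanh t < t < tan t\<close>.\<close>
    then have "sin t * cosh t - cos t * sinh t = cos t * cosh t * (tan t - tanh t)"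
      by (simp add: tan_def tanh_def field_simps)
    also have "\<dots> > 0"
      using \<open>cos t > 0\<close> tan_greater_self[OF t] tanh_less_self[OF t(1)] by simp
    finally show "sin t * cosh t - cos t * sinh t > 0" .
  qed (use assms in auto)
  then show ?thesis by simp
qed

text \<open>The difference of the two sides is the derivative of
  \<open>x\<^sup>2 - sin x * sinh x\<close>, so this is the middle of two successive integrations
  from \<open>0\<close>.\<close>

lemma cos_sinh_add_sin_cosh_less_double:
  assumes "0 < x" "x < pi / 2"
  shows "cos x * sinh x + sin x * cosh x < 2 * x"
proof -
  have "2 * x - (cos x * sinh x + sin x * cosh x) > 0"
  proof (rule pos_if_zero_and_deriv_pos[where b = "pi / 2"
        and f = "\<lambda>t. 2 * t - (cos t * sinh t + sin t * cosh t)"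
        and f' = "\<lambda>t. 2 * (1 - cos t * cosh t)"])
    show "((\<lambda>t. 2 * t - (cos t * sinh t + sin t * cosh t)) has_real_derivative
      2 * (1 - cos t * cosh t)) (at t)" for t :: real
      by (auto intro!: derivative_eq_intros simp: algebra_simps)
  qed (use assms cos_cosh_less_one in auto)
  then show ?thesis by simp
qed

lemma sin_sinh_less_square:
  assumes "0 < x" "x < pi / 2"
  shows "sin x * sinh x < x\<^sup>2"
proof -
  have "x\<^sup>2 - sin x * sinh x > 0"
  proof (rule pos_if_zero_and_deriv_pos[where b = "pi / 2" and f = "\<lambda>t. t\<^sup>2 - sin t * sinh t"
        and f' = "\<lambda>t. 2 * t - (cos t * sinh t + sin t * cosh t)"])
    show "((\<lambda>t. t\<^sup>2 - sin t * sinh t) has_real_derivative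
      2 * t - (cos t * sinh t + sin t * cosh t)) (at t)" for t :: real
      by (auto intro!: derivative_eq_intros)
  qed (use assms cos_sinh_add_sin_cosh_less_double in auto)
  then show ?thesis by simp
qed

text \<open>Common source of two claims: dividing by \<open>cos x * cosh x\<close> gives the bound
  on \<open>tan x * tanh x\<close>, dividing by \<open>x\<^sup>2\<close> the left half of the last
  chain.\<close>

lemma square_cos_cosh_less:
  assumes "0 < x" "x < pi / 2"
  shows "x\<^sup>2 * (cos x * cosh x) < sin x * sinh x"
proof -
  define a b where "a = cos x * sinh x" and "b = sin x * cosh x"
  have pos: "cos x > 0" "sin x > 0" "sinh x > 0"
    using assms cos_pos_pi_half sin_pos_pi_half by auto
  have ab: "a > 0" "b > 0" using pos by (auto simp: a_def b_def)
  have "4 * (a * b) \<le> (a + b)\<^sup>2"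
    using zero_le_power2[of "a - b"] by (simp add: power2_eq_square algebra_simps)
  then have "x\<^sup>2 * (4 * (a * b)) \<le> (x * (a + b))\<^sup>2"
    unfolding power_mult_distrib by (intro mult_left_mono) auto
  also have "\<dots> < (2 * (sin x * sinh x))\<^sup>2"
    using cos_sinh_add_sin_cosh_less[OF assms] assms ab
    by (intro power_strict_mono) (auto simp: a_def b_def)
  \<comment> \<open>Regrouping gives \<open>a * b = (sin x * sinh x) * (cos x * cosh x)\<close>, so
    one positive factor \<open>sin x * sinh x\<close> cancels afterwards.\<close>
  finally have "(sin x * sinh x) * (x\<^sup>2 * (cos x * cosh x)) < (sin x * sinh x) * (sin x * sinh x)"
    by (simp add: a_def b_def power2_eq_square algebra_simps)
  then show ?thesis using pos by simp
qed

theorem theorem4p8: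
  "\<forall>x\<in> {0<..<pi / 2}.
     cot x + coth x < 2 / x \<and>
     tan x * tanh x > x\<^sup>2 \<and>
     tan x + tanh x > 2 * x \<and>
     cos x * cosh x < (sin x * sinh x) / x\<^sup>2 \<and> (sin x * sinh x) / x\<^sup>2 < 1"
proof (intro ballI conjI)
  fix x :: real assume "x \<in> {0<..<pi / 2}"
  then have x: "0 < x" "x < pi / 2" by auto
  have pos: "cos x > 0" "sin x > 0" "sinh x > 0"
    using x cos_pos_pi_half sin_pos_pi_half by auto
  have "cot x + coth x = (cos x * sinh x + sin x * cosh x) / (sin x * sinh x)"
    using pos by (simp add: cot_def coth_def field_simps)
  also have "\<dots> < 2 / x"
    using cos_sinh_add_sin_cosh_less[OF x] pos x
    by (simp add: divide_less_eq less_divide_eq mult.commute)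
  finally show "cot x + coth x < 2 / x" .
  have "tan x * tanh x = (sin x * sinh x) / (cos x * cosh x)"
    by (simp add: tan_def tanh_def)
  also have "\<dots> > x\<^sup>2"
    using square_cos_cosh_less[OF x] pos by (simp add: less_divide_eq)
  finally show "tan x * tanh x > x\<^sup>2" .
  show "tan x + tanh x > 2 * x" by (rule tan_add_tanh_greater[OF x])
  show "cos x * cosh x < (sin x * sinh x) / x\<^sup>2"
    using square_cos_cosh_less[OF x] x by (simp add: less_divide_eq mult.commute)
  show "(sin x * sinh x) / x\<^sup>2 < 1"
    using sin_sinh_less_square[OF x] x by simp
qed

end
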